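(* If all projectors in the support of $\Pi$ commute pairwise (i.e. any two projectors in the support of the law of $P_t=I-X_t^+X_t$, $(X_t,y_t)\sim\Pi$, commute), then $F^\Pi(k)=0$ for every $k\ge1$.
   Context: A task is a pair $(X,y)$ with $X\in\mathbb R^{n\times d}$, $y\in\mathbb R^n$ ($n\ge1$ may depend on the task) and $\operatorname{rank}(X)<d$. $\Pi$ is a probability distribution on tasks. Common-solution assumption: there is a fixed vector $w^\star\in\mathbb R^d$ with $y=Xw^\star$ for every task under consideration. Tasks $(X_1,y_1),(X_2,y_2),\dots$ are i.i.d. from $\Pi$, with $X_t\in\mathbb R^{n_t\times d}$. Write $X^+$ for the Moore–Penrose pseudoinverse and $P_t:=I-X_t^+X_t$, the orthogonal projector onto $\operatorname{null}(X_t)$. Exact-fit iterates: $w_0=0$ and, for $t\ge1$, $w_t:=\arg\min\{\tfrac12\|w-w_{t-1}\|_2^2:\ w\in\mathbb R^d,\ X_tw=y_t\}$; equivalently $w_t=w_{t-1}+X_t^+(y_t-X_tw_{t-1})=w^\star+P_t(w_{t-1}-w^\star)$. Forgetting: $\ell_t(w):=\tfrac1{n_t}\|X_tw-y_t\|_2^2$ and $F^\Pi(k):=\mathbb E\big[\tfrac1k\sum_{t=1}^k\ell_t(w_k)\big]$. All expectations appearing are assumed finite; in particular $\mathbb E\|\tfrac1{n_t}X_t^\top X_t\|_F<\infty$. *)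

theory Defs
  imports "HOL-Probability.Probability"
begin

text \<open>
  The number of rows of a data matrix varies from task to task, so a task is a triple \<open>(n, X, y)\<close>:
  \<open>X\<close> is the family of rows of an \<open>n \<times> d\<close> matrix and \<open>y\<close> a vector of length \<open>n\<close>, both indexed by
  \<open>{..<n}\<close> and extensional (equal to \<open>undefined\<close> outside \<open>{..<n}\<close>, as in \<^const>\<open>PiE\<close>).
  The ambient dimension is \<open>d = CARD('d)\<close>.
\<close>

type_synonym 'd task = "nat \<times> (nat \<Rightarrow> real^'d) \<times> (nat \<Rightarrow> real)"

text \<open>
  \<open>dim (X ` {..<n})\<close> is the row rank, as in the library's \<^const>\<open>rank\<close>, which needs a fixed
  index type for the rows. The trace of the Borel sets of the product topology on this set of
  triples is the Borel sigma-algebra of the disjoint union over \<open>n\<close> of \<open>\<real>\<^sup>n\<^sup>\<times>\<^sup>d \<times> \<real>\<^sup>n\<close>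
  (restricted to rank-deficient \<open>X\<close>).
\<close>

definition task_space :: "('d::finite) task measure" where
  "task_space = restrict_space borel
     {(n, X, y). 1 \<le> n \<and> X \<in> extensional {..<n} \<and> y \<in> extensional {..<n}
        \<and> dim (X ` {..<n}) < CARD('d)}"

definition mult_vec :: "nat \<Rightarrow> (nat \<Rightarrow> real^('d::finite)) \<Rightarrow> real^'d \<Rightarrow> nat \<Rightarrow> real" where
  "mult_vec n X w = (\<lambda>i\<in>{..<n}. X i \<bullet> w)"

text \<open>
  A \<open>d \<times> n\<close> matrix \<open>Y\<close> is given by its columns \<open>Y i\<close>, \<open>i < n\<close>. Then \<open>X i \<bullet> Y j\<close> is the entry
  \<open>(i, j)\<close> of \<open>X Y\<close>, and \<open>col_row_product n Y X\<close> is the \<open>d \<times> d\<close> matrix \<open>Y X\<close>.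
\<close>

definition col_row_product :: "nat \<Rightarrow> (nat \<Rightarrow> real^('d::finite)) \<Rightarrow> (nat \<Rightarrow> real^'d) \<Rightarrow> real^'d^'d" where
  "col_row_product n Y X = (\<chi> a b. \<Sum>i<n. Y i $ a * X i $ b)"

text \<open>The four Penrose conditions, in the order
  \<open>X Y X = X\<close>, \<open>Y X Y = Y\<close>, \<open>(X Y)\<^sup>T = X Y\<close>, \<open>(Y X)\<^sup>T = Y X\<close>.\<close>

definition is_pinv :: "nat \<Rightarrow> (nat \<Rightarrow> real^('d::finite)) \<Rightarrow> (nat \<Rightarrow> real^'d) \<Rightarrow> bool" where
  "is_pinv n X Y \<longleftrightarrow>
     (\<forall>i<n. (\<Sum>j<n. (X i \<bullet> Y j) *\<^sub>R X j) = X i) \<and>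
     (\<forall>i<n. (\<Sum>j<n. (X j \<bullet> Y i) *\<^sub>R Y j) = Y i) \<and>
     (\<forall>i<n. \<forall>j<n. X j \<bullet> Y i = X i \<bullet> Y j) \<and>
     transpose (col_row_product n Y X) = col_row_product n Y X"

definition pinv :: "nat \<Rightarrow> (nat \<Rightarrow> real^('d::finite)) \<Rightarrow> nat \<Rightarrow> real^'d" where
  "pinv n X = (THE Y. Y \<in> extensional {..<n} \<and> is_pinv n X Y)"

definition null_projector :: "('d::finite) task \<Rightarrow> real^'d^'d" where
  "null_projector = (\<lambda>(n, X, y). mat 1 - col_row_product n (pinv n X) X)"

definition fit_step :: "('d::finite) task \<Rightarrow> real^'d \<Rightarrow> real^'d" where
  "fit_step = (\<lambda>(n, X, y) u. ARG_MIN (\<lambda>w. 1/2 * (norm (w - u))\<^sup>2) w. mult_vec n X w = y)"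

text \<open>Tasks are numbered from 1; the entry \<open>\<tau> 0\<close> of a task sequence is never used.\<close>

primrec iterate :: "(nat \<Rightarrow> ('d::finite) task) \<Rightarrow> nat \<Rightarrow> real^'d" where
  "iterate \<tau> 0 = 0"
| "iterate \<tau> (Suc t) = fit_step (\<tau> (Suc t)) (iterate \<tau> t)"

definition loss :: "('d::finite) task \<Rightarrow> real^'d \<Rightarrow> real" where
  "loss = (\<lambda>(n, X, y) w. 1 / real n * (\<Sum>i<n. (mult_vec n X w i - y i)\<^sup>2))"

definition average_loss :: "(nat \<Rightarrow> ('d::finite) task) \<Rightarrow> nat \<Rightarrow> real" where
  "average_loss \<tau> k = 1 / real k * (\<Sum>t=1..k. loss (\<tau> t) (iterate \<tau> k))"

definition forgetting :: "'w measure \<Rightarrow> (nat \<Rightarrow> 'w \<Rightarrow> ('d::finite) task) \<Rightarrow> nat \<Rightarrow> real" where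
  "forgetting M T k = (\<integral>\<omega>. average_loss (\<lambda>t. T t \<omega>) k \<partial>M)"

text \<open>\<open>norm\<close> on \<^typ>\<open>real^'d^'d\<close> is the Frobenius norm.\<close>

definition normalized_gram :: "('d::finite) task \<Rightarrow> real^'d^'d" where
  "normalized_gram = (\<lambda>(n, X, y). (1 / real n) *\<^sub>R col_row_product n X X)"

definition measure_support :: "'a::topological_space measure \<Rightarrow> 'a set" where
  "measure_support \<mu> = {x \<in> space \<mu>. \<forall>U. open U \<and> x \<in> U \<longrightarrow> emeasure \<mu> U > 0}"

end

theory Submission
  imports Defs
begin

text \<open>
  The error \<open>z\<^sub>t = w\<^sub>t - w\<^sup>\<star>\<close> obeys \<open>z\<^sub>t = P\<^sub>t z\<^sub>t\<^sub>-\<^sub>1\<close>. A vector fixed by \<open>P\<^sub>t\<close> stays fixed by \<open>P\<^sub>t\<close> after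
  applying a projector that commutes with \<open>P\<^sub>t\<close>, so \<open>z\<^sub>k\<close> is fixed by all of \<open>P\<^sub>1, \<dots>, P\<^sub>k\<close>, i.e.
  \<open>X\<^sub>t z\<^sub>k = 0\<close> for \<open>t \<le> k\<close>, and every loss vanishes. This applies almost surely, because on a
  second-countable space a Borel measure is concentrated on its support. The law of the projector is
  a genuine push-forward only if \<open>null_projector\<close> is measurable; this follows from an explicit
  Gram--Schmidt recursion for the projector.
\<close>

section \<open>Projectors onto the null space of a matrix\<close>

text \<open>An intrinsic description of the orthogonal projector, free of the pseudoinverse: range
  in the null space, identity there, self-adjoint. Idempotence follows from the first two clauses.
  It serves to identify differently built projectors.\<close>

definition is_null_projector :: "nat \<Rightarrow> (nat \<Rightarrow> real^('d::finite)) \<Rightarrow> real^'d^'d \<Rightarrow> bool" where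
  "is_null_projector n X P \<longleftrightarrow>
     (\<forall>i<n. \<forall>v. X i \<bullet> (P *v v) = 0) \<and>
     (\<forall>v. (\<forall>i<n. X i \<bullet> v = 0) \<longrightarrow> P *v v = v) \<and>
     (\<forall>v w. (P *v v) \<bullet> w = v \<bullet> (P *v w))"

lemma is_null_projectorD:
  assumes "is_null_projector n X P"
  shows "i < n \<Longrightarrow> X i \<bullet> (P *v v) = 0"
    and "(\<And>i. i < n \<Longrightarrow> X i \<bullet> v = 0) \<Longrightarrow> P *v v = v"
    and "(P *v v) \<bullet> w = v \<bullet> (P *v w)"
    and "P *v (P *v v) = P *v v"
  using assms unfolding is_null_projector_def by blast+

text \<open>Each projector fixes the range of the other, so \<open>Q P = P\<close> and
  \<open>P Q = Q\<close>; taking adjoints in one of these gives \<open>P = Q\<close>.\<close>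

lemma is_null_projector_unique:
  assumes "is_null_projector n X P" "is_null_projector n X Q"
  shows "P = Q"
proof -
  have "(P *v v) \<bullet> w = (Q *v v) \<bullet> w" for v w
  proof -
    have "Q *v (P *v v) = P *v v" "P *v (Q *v w) = Q *v w"
      using assms by (auto intro: is_null_projectorD)
    then show ?thesis
      using is_null_projectorD(3)[OF assms(1), of v "Q *v w"]
        is_null_projectorD(3)[OF assms(2), of "P *v v" w]
        is_null_projectorD(3)[OF assms(2), of v w] by simp
  qed
  then show ?thesis
    by (metis matrix_eq vector_eq_rdot)
qed

text \<open>Here \<open>p\<close> is the part of row \<open>n\<close> orthogonal to the earlier
  rows, and the correction removes the line through \<open>p\<close>. The factor
  \<open>X n \<bullet> p\<close> equals \<open>p \<bullet> p\<close>, as \<open>P\<close> is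
  symmetric and idempotent.\<close>

primrec gram_schmidt_projector :: "nat \<Rightarrow> (nat \<Rightarrow> real^('d::finite)) \<Rightarrow> real^'d^'d" where
  "gram_schmidt_projector 0 X = mat 1"
| "gram_schmidt_projector (Suc n) X =
     (let P = gram_schmidt_projector n X; p = P *v X n
      in P - inverse (X n \<bullet> p) *\<^sub>R (\<chi> a b. p $ a * p $ b))"

lemma outer_product_mult_vec: "(\<chi> a b. p $ a * q $ b) *v v = (q \<bullet> v) *\<^sub>R (p :: real^'d::finite)"
  by (simp add: vec_eq_iff matrix_vector_mult_def inner_vec_def sum_distrib_right sum_distrib_left
      mult_ac)

text \<open>If row \<open>n\<close> lies in the span of the earlier rows, then \<open>p = 0\<close> and \<open>inverse 0 = 0\<close> leaves the
  projector unchanged, as it should.\<close>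

lemma is_null_projector_gram_schmidt: "is_null_projector n X (gram_schmidt_projector n X)"
proof (induction n)
  case 0
  then show ?case by (simp add: is_null_projector_def)
next
  case (Suc n)
  define P where "P = gram_schmidt_projector n X"
  define p where "p = P *v X n"
  have P: "is_null_projector n X P" using Suc by (simp add: P_def)
  have sym: "p \<bullet> v = X n \<bullet> (P *v v)" for v
    unfolding p_def by (rule is_null_projectorD(3)[OF P])
  have norm_p: "X n \<bullet> p = p \<bullet> p"
    using sym[of p] is_null_projectorD(4)[OF P] by (simp add: p_def)
  have step: "gram_schmidt_projector (Suc n) X *v v = P *v v - ((p \<bullet> v) / (p \<bullet> p)) *\<^sub>R p" for v
    by (simp add: Let_def norm_p[symmetric] P_def[symmetric] p_def[symmetric]
        matrix_vector_mult_diff_rdistrib scaleR_matrix_vector_assoc[symmetric]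
        outer_product_mult_vec divide_inverse mult.commute)
  show ?case
    unfolding is_null_projector_def step
  proof (intro conjI allI impI)
    fix i v assume "i < Suc n"
    then consider "i < n" | "i = n" by linarith
    then show "X i \<bullet> (P *v v - ((p \<bullet> v) / (p \<bullet> p)) *\<^sub>R p) = 0"
    proof cases
      case 1
      then show ?thesis
        using is_null_projectorD(1)[OF P] by (simp add: inner_diff_right p_def)
    next
      case 2
      then show ?thesis
        using sym[of v] norm_p by (cases "p = 0") (simp_all add: inner_diff_right)
    qed
  next
    fix v assume v: "\<forall>i<Suc n. X i \<bullet> v = 0"
    then have "P *v v = v" by (auto intro: is_null_projectorD(2)[OF P])
    then show "P *v v - ((p \<bullet> v) / (p \<bullet> p)) *\<^sub>R p = v"
      using v sym[of v] by simp
  next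
    fix v w
    show "(P *v v - ((p \<bullet> v) / (p \<bullet> p)) *\<^sub>R p) \<bullet> w = v \<bullet> (P *v w - ((p \<bullet> w) / (p \<bullet> p)) *\<^sub>R p)"
      using is_null_projectorD(3)[OF P, of v w]
      by (simp add: inner_diff_right inner_diff_left inner_commute)
  qed
qed

section \<open>The pseudoinverse\<close>

lemma col_row_product_mult_vec: "col_row_product n Y X *v v = (\<Sum>i<n. (X i \<bullet> v) *\<^sub>R Y i)"
proof -
  have "(\<Sum>b\<in>UNIV. (\<Sum>i<n. Y i $ a * X i $ b) * v $ b) = (\<Sum>i<n. (\<Sum>b\<in>UNIV. X i $ b * v $ b) * Y i $ a)"
    for a
    unfolding sum_distrib_right by (subst sum.swap) (simp add: mult_ac)
  then show ?thesis
    by (simp add: vec_eq_iff col_row_product_def matrix_vector_mult_def inner_vec_def)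
qed

lemma symmetric_matrix_inner:
  fixes A :: "real^'d::finite^'d"
  assumes "transpose A = A"
  shows "(A *v v) \<bullet> w = v \<bullet> (A *v w)"
  using assms by (metis dot_lmul_matrix transpose_matrix_vector)

text \<open>\<open>X Y X = X\<close> gives \<open>X (I - Y X) = 0\<close>, and symmetry of
  \<open>Y X\<close> passes to \<open>I - Y X\<close>. If \<open>X v = 0\<close>, then
  \<open>Y X v = 0\<close>, so \<open>v\<close> is fixed.\<close>

lemma is_null_projector_pinv:
  assumes "is_pinv n X Y"
  shows "is_null_projector n X (mat 1 - col_row_product n Y X)"
proof -
  have XYX: "(\<Sum>j<n. (X i \<bullet> Y j) *\<^sub>R X j) = X i" if "i < n" for i
    using assms that unfolding is_pinv_def by blast
  have sym: "transpose (col_row_product n Y X) = col_row_product n Y X"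
    using assms by (simp add: is_pinv_def)
  have mult: "(mat 1 - col_row_product n Y X) *v v = v - (\<Sum>i<n. (X i \<bullet> v) *\<^sub>R Y i)" for v
    by (simp add: matrix_vector_mult_diff_rdistrib col_row_product_mult_vec)
  have "X i \<bullet> ((mat 1 - col_row_product n Y X) *v v) = 0" if "i < n" for i v
  proof -
    have "X i \<bullet> v = (\<Sum>j<n. (X i \<bullet> Y j) *\<^sub>R X j) \<bullet> v"
      using XYX[OF that] by simp
    then show ?thesis
      by (simp add: mult inner_diff_right inner_sum_left inner_sum_right mult.commute)
  qed
  moreover have "((mat 1 - col_row_product n Y X) *v v) \<bullet> w = v \<bullet> ((mat 1 - col_row_product n Y X) *v w)"
    for v w
    using symmetric_matrix_inner[OF sym, of v w]
    by (simp add: matrix_vector_mult_diff_rdistrib inner_diff_left inner_diff_right)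
  ultimately show ?thesis
    unfolding is_null_projector_def by (simp add: mult)
qed

text \<open>First \<open>X Z = X Y X Z\<close>, whose transpose is \<open>X Z X Y = X Y\<close>; by
  symmetry \<open>X Y = X Z\<close>. Uniqueness of the null projector gives
  \<open>Y X = Z X\<close>. Hence \<open>Y = Y X Y = Y X Z = Z X Z = Z\<close>.\<close>

lemma is_pinv_unique:
  assumes Y: "is_pinv n X Y" and Z: "is_pinv n X Z" and "i < n"
  shows "Y i = Z i"
proof -
  have XYX: "(\<Sum>l<n. (X j \<bullet> W l) *\<^sub>R X l) = X j" and sym: "X l \<bullet> W j = X j \<bullet> W l"
    and YXY: "(\<Sum>l<n. (X l \<bullet> W j) *\<^sub>R W l) = W j"
    if "is_pinv n X W" "j < n" "l < n" for W j l
    using that unfolding is_pinv_def by blast+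
  have prod: "(\<Sum>l<n. (X j \<bullet> W l) * (X l \<bullet> v)) = X j \<bullet> v" if "is_pinv n X W" "j < n" for W j v
    using arg_cong[OF XYX[OF that that(2)], of "\<lambda>x. x \<bullet> v"] by (simp add: inner_sum_left)
  have same: "X j \<bullet> Y i = X j \<bullet> Z i" if "j < n" for j
  proof -
    have "X j \<bullet> Z i = (\<Sum>l<n. (X j \<bullet> Y l) * (X l \<bullet> Z i))"
      using prod[OF Y that, of "Z i"] by simp
    also have "\<dots> = (\<Sum>l<n. (X i \<bullet> Z l) * (X l \<bullet> Y j))"
      using sym[OF Y] sym[OF Z] that \<open>i < n\<close> by (intro sum.cong) auto
    also have "\<dots> = X i \<bullet> Y j"
      using prod[OF Z \<open>i < n\<close>, of "Y j"] by simp
    finally show ?thesis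
      using sym[OF Y] that \<open>i < n\<close> by simp
  qed
  have "mat 1 - col_row_product n Y X = mat 1 - col_row_product n Z X"
    using is_null_projector_unique is_null_projector_pinv Y Z by blast
  then have proj: "col_row_product n Y X *v v = col_row_product n Z X *v v" for v
    by simp
  have "Y i = (\<Sum>l<n. (X l \<bullet> Z i) *\<^sub>R Y l)"
    using YXY[OF Y \<open>i < n\<close> \<open>i < n\<close>] same by simp
  also have "\<dots> = (\<Sum>l<n. (X l \<bullet> Z i) *\<^sub>R Z l)"
    using proj[of "Z i"] by (simp add: col_row_product_mult_vec)
  also have "\<dots> = Z i"
    using YXY[OF Z \<open>i < n\<close> \<open>i < n\<close>] .
  finally show ?thesis .
qed

text \<open>With \<open>P\<close> the projector onto the null space of \<open>X\<close>, the symmetric map \<open>H = X\<^sup>T X + P\<close> is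
  injective, and \<open>H\<^sup>-\<^sup>1 X\<^sup>T\<close> is the pseudoinverse, because \<open>H\<^sup>-\<^sup>1 P = P\<close> and hence \<open>H\<^sup>-\<^sup>1 X\<^sup>T X = I - P\<close>.\<close>

lemma is_pinv_exists:
  fixes X :: "nat \<Rightarrow> real^'d::finite"
  shows "\<exists>Y. is_pinv n X Y"
proof -
  define P where "P = gram_schmidt_projector n X"
  have P: "is_null_projector n X P"
    unfolding P_def by (rule is_null_projector_gram_schmidt)
  define G where "G v = (\<Sum>i<n. (X i \<bullet> v) *\<^sub>R X i)" for v
  define H where "H v = G v + P *v v" for v
  have lin_H: "linear H"
    unfolding H_def G_def
    by (intro linearI) (simp_all add: inner_add_right scaleR_add_left sum.distrib scaleR_sum_right
        matrix_vector_right_distrib algebra_simps matrix_vector_mult_scaleR)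
  have sym_H: "H v \<bullet> w = v \<bullet> H w" for v w
    using is_null_projectorD(3)[OF P, of v w]
    by (simp add: H_def G_def inner_add_left inner_add_right inner_sum_left inner_sum_right
        inner_commute mult.commute)
  have "v = 0" if "H v = 0" for v
  proof -
    \<comment> \<open>Positivity of the quadratic form of \<open>H\<close>: a kernel vector
      satisfies both \<open>X v = 0\<close> and \<open>P v = 0\<close>, while \<open>X v = 0\<close>
      forces \<open>P v = v\<close>.\<close>
    have "(\<Sum>i<n. (X i \<bullet> v)\<^sup>2) + (P *v v) \<bullet> (P *v v) = H v \<bullet> v"
      using is_null_projectorD(3)[OF P, of "P *v v" v] is_null_projectorD(4)[OF P, of v]
      by (simp add: H_def G_def inner_add_left inner_sum_left power2_eq_square)
    then have "(\<Sum>i<n. (X i \<bullet> v)\<^sup>2) + (P *v v) \<bullet> (P *v v) = 0"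
      using that by simp
    then have "(\<Sum>i<n. (X i \<bullet> v)\<^sup>2) = 0" and Pv: "P *v v = 0"
      by (simp_all add: add_nonneg_eq_0_iff sum_nonneg)
    then have "\<And>i. i < n \<Longrightarrow> X i \<bullet> v = 0"
      by (simp add: sum_nonneg_eq_0_iff)
    then show ?thesis
      using is_null_projectorD(2)[OF P] Pv by metis
  qed
  then have "inj H"
    using lin_H linear_injective_0 by blast
  then obtain h where lin_h: "linear h" and hH: "\<And>v. h (H v) = v" and Hh: "\<And>v. H (h v) = v"
    using linear_injective_isomorphism[OF lin_H] by blast
  have sym_h: "h v \<bullet> w = v \<bullet> h w" for v w
    using sym_H[of "h v" "h w"] Hh by simp
  have HP: "H (P *v v) = P *v v" for v
    using is_null_projectorD(1,4)[OF P] by (simp add: H_def G_def)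
  have hG: "(\<Sum>i<n. (X i \<bullet> v) *\<^sub>R h (X i)) = v - P *v v" for v
  proof -
    have "h (P *v v) = P *v v" using hH HP by metis
    then have "h (G v) = v - P *v v"
      using hH[of v] lin_h by (simp add: H_def linear_add eq_diff_eq)
    then show ?thesis
      using lin_h by (simp add: G_def linear_sum linear_cmul)
  qed
  \<comment> \<open>Moving \<open>P\<close> and \<open>h\<close> to the other side of the inner
    product leaves \<open>X i\<close> against a vector in the range of \<open>P\<close>, which is
    orthogonal to the rows.\<close>
  have hP: "P *v h (X i) = 0" if "i < n" for i
  proof -
    have "(P *v h (X i)) \<bullet> w = 0" for w
    proof -
      have "(P *v h (X i)) \<bullet> w = X i \<bullet> h (P *v w)"
        using is_null_projectorD(3)[OF P] sym_h by simp
      also have "h (P *v w) = P *v w" using hH HP by metis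
      finally show ?thesis using is_null_projectorD(1)[OF P that] by simp
    qed
    then show ?thesis by (metis inner_eq_zero_iff)
  qed
  have "is_pinv n X (\<lambda>i. h (X i))"
    unfolding is_pinv_def
  proof (intro conjI allI impI)
    fix i assume i: "i < n"
    have "(\<Sum>j<n. (X i \<bullet> h (X j)) *\<^sub>R X j) = G (h (X i))"
      by (simp add: G_def sym_h[of "X i"] inner_commute[of "X _" "h (X i)"])
    also have "\<dots> = X i"
      using Hh[of "X i"] hP[OF i] by (simp add: H_def)
    finally show "(\<Sum>j<n. (X i \<bullet> h (X j)) *\<^sub>R X j) = X i" .
    show "(\<Sum>j<n. (X j \<bullet> h (X i)) *\<^sub>R h (X j)) = h (X i)"
      using hG[of "h (X i)"] hP[OF i] by simp
    fix j assume "j < n"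
    show "X j \<bullet> h (X i) = X i \<bullet> h (X j)"
      using sym_h[of "X i" "X j"] by (simp add: inner_commute)
  next
    let ?Q = "col_row_product n (\<lambda>i. h (X i)) X"
    \<comment> \<open>By \<open>hG\<close>, \<open>?Q\<close> acts as \<open>I - P\<close>, so it
      inherits self-adjointness from \<open>P\<close>.\<close>
    have "(?Q *v v) \<bullet> w = (transpose ?Q *v v) \<bullet> w" for v w
    proof -
      have "(?Q *v v) \<bullet> w = v \<bullet> (?Q *v w)"
        using is_null_projectorD(3)[OF P]
        by (simp add: col_row_product_mult_vec hG inner_diff_left inner_diff_right)
      then show ?thesis
        by (simp add: dot_lmul_matrix)
    qed
    then show "transpose ?Q = ?Q"
      by (metis matrix_eq vector_eq_rdot)
  qed
  then show ?thesis by blast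
qed

lemma is_pinv_pinv: "is_pinv n X (pinv n X)"
proof -
  obtain Y where Y: "is_pinv n X Y" using is_pinv_exists by blast
  \<comment> \<open>The Penrose conditions read indices below \<open>n\<close> alone; restricting
    picks the extensional representative, which makes the definite description unique.\<close>
  define Z where "Z = restrict Y {..<n}"
  have "is_pinv n X Z = is_pinv n X Y"
    by (simp add: is_pinv_def Z_def col_row_product_def)
  then have Z: "is_pinv n X Z" using Y by simp
  have "\<exists>!Y. Y \<in> extensional {..<n} \<and> is_pinv n X Y"
  proof (rule ex1I)
    show "Z \<in> extensional {..<n} \<and> is_pinv n X Z"
      using Z by (simp add: Z_def)
  next
    fix W assume "W \<in> extensional {..<n} \<and> is_pinv n X W"
    then show "W = Z"
      using is_pinv_unique[OF _ Z] by (intro extensionalityI[of _ "{..<n}"]) (auto simp: Z_def)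
  qed
  from theI'[OF this] show ?thesis by (simp add: pinv_def)
qed

lemma is_null_projector_null_projector: "is_null_projector n X (null_projector (n, X, y))"
  unfolding null_projector_def using is_null_projector_pinv[OF is_pinv_pinv] by simp

section \<open>Measurability and support\<close>

lemma null_projector_eq_gram_schmidt:
  "null_projector \<tau> = gram_schmidt_projector (fst \<tau>) (fst (snd \<tau>))"
  using is_null_projector_unique[OF is_null_projector_null_projector is_null_projector_gram_schmidt]
  by (cases \<tau>) auto

text \<open>For fixed \<open>n\<close> the recursion combines continuous operations with
  \<open>inverse\<close>, which is Borel despite its jump at 0. The depth \<open>n\<close> varies
  with the task but takes countably many values, so the levels can be glued.\<close>

lemma borel_measurable_null_projector:
  "(null_projector :: ('d::finite) task \<Rightarrow> real^'d^'d) \<in> borel_measurable borel"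
proof -
  have row: "(\<lambda>\<tau>::'d task. fst (snd \<tau>) i) \<in> borel_measurable borel" for i
    by (rule borel_measurable_continuous_onI, rule continuous_on_product_then_coordinatewise)
      (intro continuous_intros)
  have gs: "(\<lambda>\<tau>::'d task. gram_schmidt_projector n (fst (snd \<tau>))) \<in> borel_measurable borel" for n
  proof (induction n)
    case (Suc n)
    have p: "(\<lambda>\<tau>::'d task. gram_schmidt_projector n (fst (snd \<tau>)) *v fst (snd \<tau>) n)
        \<in> borel_measurable borel"
      by (rule borel_measurable_continuous_Pair[OF Suc row])
        (unfold matrix_vector_mult_def, intro continuous_intros)
    have outer: "(\<lambda>p::real^'d. \<chi> a b. p $ a * p $ b) \<in> borel_measurable borel"
      by (intro borel_measurable_continuous_onI continuous_intros)
    show ?case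
      unfolding gram_schmidt_projector.simps Let_def
      by (intro borel_measurable_diff borel_measurable_scaleR borel_measurable_inverse
          borel_measurable_inner Suc p row measurable_compose[OF p outer])
  qed simp
  have "(\<lambda>\<tau>::'d task. fst \<tau>) \<in> borel_measurable borel"
    by (intro borel_measurable_continuous_onI continuous_intros)
  then have dim: "(\<lambda>\<tau>::'d task. fst \<tau>) \<in> measurable borel (count_space UNIV)"
    by (simp add: measurable_cong_sets[OF refl sets_borel_eq_count_space])
  have "(\<lambda>\<tau>::'d task. gram_schmidt_projector (fst \<tau>) (fst (snd \<tau>))) \<in> borel_measurable borel"
    by (rule measurable_compose_countable[OF gs dim])
  then show ?thesis
    by (simp add: null_projector_eq_gram_schmidt[abs_def])
qed

text \<open>Every point outside the support lies in a null basic open set, and a countable basis has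
  only countably many of these.\<close>

lemma AE_in_measure_support:
  fixes \<mu> :: "'a::second_countable_topology measure"
  assumes "sets \<mu> = sets borel"
  shows "AE x in \<mu>. x \<in> measure_support \<mu>"
proof -
  obtain B :: "'a set set" where B: "countable B" "topological_basis B"
    using ex_countable_basis by blast
  have space: "space \<mu> = UNIV"
    using sets_eq_imp_space_eq[OF assms] by simp
  have open_sets: "U \<in> sets \<mu>" if "open U" for U
    using assms that by simp
  let ?N = "{U \<in> B. emeasure \<mu> U = 0}"
  have null: "(\<Union>U\<in>?N. U) \<in> null_sets \<mu>"
    using B by (intro null_sets_UN') (auto simp: null_sets_def open_sets topological_basis_open)
  show ?thesis
  proof (rule AE_I'[OF null], clarsimp)
    fix x assume "x \<notin> measure_support \<mu>"
    then obtain U where U: "open U" "x \<in> U" "emeasure \<mu> U = 0"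
      unfolding measure_support_def by (auto simp: space zero_less_iff_neq_zero)
    obtain V where V: "V \<in> B" "x \<in> V" "V \<subseteq> U"
      using topological_basisE[OF B(2) U(1,2)] by metis
    have "emeasure \<mu> V = 0"
      using emeasure_mono[OF V(3) open_sets[OF U(1)]] U(3) by simp
    then show "\<exists>V. V \<in> B \<and> emeasure \<mu> V = 0 \<and> x \<in> V"
      using V by blast
  qed
qed

section \<open>Exact-fit iterates\<close>

text \<open>For feasible \<open>x\<close>, the difference \<open>x - v\<close> lies in the null
  space of \<open>X\<close>, whereas \<open>v - u = -(I - P)(u - w)\<close> is orthogonal to it.
  Pythagoras then singles out \<open>v\<close>.\<close>

lemma fit_step_eq:
  "fit_step (n, X, mult_vec n X w) u = w + null_projector (n, X, mult_vec n X w) *v (u - w)"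
proof -
  define P where "P = null_projector (n, X, mult_vec n X w)"
  have P: "is_null_projector n X P"
    unfolding P_def by (rule is_null_projector_null_projector)
  define v where "v = w + P *v (u - w)"
  have feasible_iff: "mult_vec n X x = mult_vec n X w \<longleftrightarrow> (\<forall>i<n. X i \<bullet> (x - w) = 0)" for x
    by (auto simp: mult_vec_def restrict_def fun_eq_iff inner_diff_right)
  have feasible: "mult_vec n X v = mult_vec n X w"
    using is_null_projectorD(1)[OF P] by (simp add: feasible_iff v_def)
  have pythagoras: "(norm (x - u))\<^sup>2 = (norm (x - v))\<^sup>2 + (norm (v - u))\<^sup>2"
    if "mult_vec n X x = mult_vec n X w" for x
  proof -
    have "P *v (x - v) = x - v"
    proof (rule is_null_projectorD(2)[OF P])
      fix i assume "i < n"
      then have "X i \<bullet> (x - w) = 0" "X i \<bullet> (v - w) = 0"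
        using that feasible by (simp_all add: feasible_iff)
      then show "X i \<bullet> (x - v) = 0" by (simp add: inner_diff_right)
    qed
    moreover have "P *v (v - u) = 0"
      using is_null_projectorD(4)[OF P, of "u - w"]
      by (simp add: v_def matrix_vector_right_distrib matrix_vector_mult_diff_distrib)
    ultimately have "(x - v) \<bullet> (v - u) = 0"
      using is_null_projectorD(3)[OF P, of "x - v" "v - u"] by simp
    then show ?thesis
      using norm_add_Pythagorean[of "x - v" "v - u"] by (simp add: orthogonal_def)
  qed
  \<comment> \<open>\<open>ARG_MIN\<close> is a choice among minimizers, so its value is known only
    once \<open>v\<close> is shown to be the sole one.\<close>
  have "is_arg_min (\<lambda>x. 1/2 * (norm (x - u))\<^sup>2) (\<lambda>x. mult_vec n X x = mult_vec n X w) x \<longleftrightarrow> x = v" for x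
  proof
    assume min: "is_arg_min (\<lambda>x. 1/2 * (norm (x - u))\<^sup>2) (\<lambda>x. mult_vec n X x = mult_vec n X w) x"
    then have "(norm (x - u))\<^sup>2 \<le> (norm (v - u))\<^sup>2" "mult_vec n X x = mult_vec n X w"
      using feasible by (auto simp: is_arg_min_linorder)
    then show "x = v" using pythagoras[of x] by simp
  next
    assume "x = v"
    moreover have "(norm (v - u))\<^sup>2 \<le> (norm (z - u))\<^sup>2" if "mult_vec n X z = mult_vec n X w" for z
      unfolding pythagoras[OF that] by simp
    ultimately show "is_arg_min (\<lambda>x. 1/2 * (norm (x - u))\<^sup>2) (\<lambda>x. mult_vec n X x = mult_vec n X w) x"
      using feasible by (auto simp: is_arg_min_linorder)
  qed
  then have "is_arg_min (\<lambda>x. 1/2 * (norm (x - u))\<^sup>2) (\<lambda>x. mult_vec n X x = mult_vec n X w) = (\<lambda>x. x = v)"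
    by (intro ext)
  then show ?thesis
    by (simp add: fit_step_def arg_min_def v_def[symmetric] P_def[symmetric])
qed

lemma iterate_error_fixed:
  assumes fit: "\<And>t. 1 \<le> t \<Longrightarrow> snd (snd (\<tau> t)) = mult_vec (fst (\<tau> t)) (fst (snd (\<tau> t))) w"
    and comm: "\<And>s t. 1 \<le> s \<Longrightarrow> 1 \<le> t \<Longrightarrow>
      null_projector (\<tau> s) ** null_projector (\<tau> t) = null_projector (\<tau> t) ** null_projector (\<tau> s)"
    and "1 \<le> t" "t \<le> k"
  shows "null_projector (\<tau> t) *v (iterate \<tau> k - w) = iterate \<tau> k - w"
  using \<open>t \<le> k\<close>
proof (induction k)
  case 0
  then show ?case using \<open>1 \<le> t\<close> by simp
next
  case (Suc k)
  obtain n X y where \<tau>: "\<tau> (Suc k) = (n, X, y)" by (cases "\<tau> (Suc k)")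
  have step: "iterate \<tau> (Suc k) - w = null_projector (\<tau> (Suc k)) *v (iterate \<tau> k - w)"
    using fit[of "Suc k"] by (simp add: \<tau> fit_step_eq)
  show ?case
  proof (cases "t = Suc k")
    case True
    then show ?thesis
      unfolding step
      using is_null_projectorD(4)[OF is_null_projector_null_projector] by (simp add: \<tau>)
  next
    case False
    then have "null_projector (\<tau> t) *v (iterate \<tau> k - w) = iterate \<tau> k - w"
      using Suc by simp
    then show ?thesis
      unfolding step using comm[OF \<open>1 \<le> t\<close>, of "Suc k"]
      by (metis le_add1 matrix_vector_mul_assoc plus_1_eq_Suc)
  qed
qed

lemma average_loss_eq_0:
  assumes fit: "\<And>t. 1 \<le> t \<Longrightarrow> snd (snd (\<tau> t)) = mult_vec (fst (\<tau> t)) (fst (snd (\<tau> t))) w"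
    and comm: "\<And>s t. 1 \<le> s \<Longrightarrow> 1 \<le> t \<Longrightarrow>
      null_projector (\<tau> s) ** null_projector (\<tau> t) = null_projector (\<tau> t) ** null_projector (\<tau> s)"
  shows "average_loss \<tau> k = 0"
proof -
  have "loss (\<tau> t) (iterate \<tau> k) = 0" if t: "1 \<le> t" "t \<le> k" for t
  proof -
    obtain n X y where \<tau>: "\<tau> t = (n, X, y)" by (cases "\<tau> t")
    have "null_projector (n, X, y) *v (iterate \<tau> k - w) = iterate \<tau> k - w"
      using iterate_error_fixed[of \<tau> w t k] fit comm t by (simp add: \<tau>)
    then have "X i \<bullet> (iterate \<tau> k - w) = 0" if "i < n" for i
      using is_null_projectorD(1)[OF is_null_projector_null_projector that] by metis
    then show ?thesis
      using fit[OF t(1)] by (simp add: \<tau> loss_def mult_vec_def inner_diff_right)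
  qed
  then show ?thesis by (simp add: average_loss_def)
qed

theorem proposition4p6:
  fixes D :: "('d::finite) task measure"
    and M :: "'w measure"
    and T :: "nat \<Rightarrow> 'w \<Rightarrow> 'd task"
    and wstar :: "real^'d"
  assumes D_prob: "prob_space D"
    and D_sets: "sets D = sets task_space"
    and common_solution: "AE (n, X, y) in D. y = mult_vec n X wstar"
    and M_prob: "prob_space M"
    and T_indep: "prob_space.indep_vars M (\<lambda>_. task_space) T {1..}"
    and T_law: "\<And>t. 1 \<le> t \<Longrightarrow> distr M task_space (T t) = D"
    and gram_finite: "integrable D (\<lambda>\<tau>. norm (normalized_gram \<tau>))"
    and forgetting_finite: "\<And>k. 1 \<le> k \<Longrightarrow> integrable M (\<lambda>\<omega>. average_loss (\<lambda>t. T t \<omega>) k)"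
    and commuting: "\<And>A B. A \<in> measure_support (distr D borel null_projector) \<Longrightarrow>
                     B \<in> measure_support (distr D borel null_projector) \<Longrightarrow> A ** B = B ** A"
  shows "\<forall>k\<ge>1. forgetting M T k = 0"
proof (intro allI impI)
  fix k :: nat assume "1 \<le> k"
  let ?S = "measure_support (distr D borel null_projector)"
  have "null_projector \<in> borel_measurable (task_space :: 'd task measure)"
    unfolding task_space_def by (intro measurable_restrict_space1 borel_measurable_null_projector)
  then have meas: "null_projector \<in> borel_measurable D"
    by (simp add: measurable_cong_sets[OF D_sets refl])
  have "AE \<tau> in D. null_projector \<tau> \<in> ?S"
    by (rule AE_distrD[OF meas AE_in_measure_support]) simp
  then have D: "AE \<tau> in D. null_projector \<tau> \<in> ?S \<and>
      snd (snd \<tau>) = mult_vec (fst \<tau>) (fst (snd \<tau>)) wstar"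
    using common_solution by eventually_elim auto
  have "AE \<omega> in M. 1 \<le> t \<longrightarrow> null_projector (T t \<omega>) \<in> ?S \<and>
      snd (snd (T t \<omega>)) = mult_vec (fst (T t \<omega>)) (fst (snd (T t \<omega>))) wstar" for t
  proof (cases "1 \<le> t")
    case True
    \<comment> \<open>Measurability is part of independence; it allows the almost sure statement
      under \<open>D\<close> to be pulled back along \<open>T t\<close>, whose law is
      \<open>D\<close>.\<close>
    then have "T t \<in> measurable M task_space"
      using T_indep unfolding prob_space.indep_vars_def[OF M_prob] by auto
    then show ?thesis
      using AE_distrD[of "T t" M task_space] D T_law[OF True] True by auto
  qed simp
  then have "AE \<omega> in M. \<forall>t. 1 \<le> t \<longrightarrow> null_projector (T t \<omega>) \<in> ?S \<and>
      snd (snd (T t \<omega>)) = mult_vec (fst (T t \<omega>)) (fst (snd (T t \<omega>))) wstar"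
    by (simp add: AE_all_countable)
  then have "AE \<omega> in M. average_loss (\<lambda>t. T t \<omega>) k = 0"
    by eventually_elim (rule average_loss_eq_0[where w = wstar], auto intro: commuting)
  then show "forgetting M T k = 0"
    unfolding forgetting_def by (rule integral_eq_zero_AE)
qed

end
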